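(* There is an absolute constant $c$ such that the following holds. Let $G$ be an $n$-vertex topological graph such that for every two crossing edges $e$ and $e'$ of $G$, the edges $e$ and $e'$ are independent and there is a crossing-free edge of $G$ that connects an endpoint of $e$ and an endpoint of $e'$. Then $G$ has at most $cn$ edges.
   Context: Graphs have no loops or parallel edges. A topological graph is a graph drawn in the plane with its vertices as distinct points and its edges as Jordan arcs connecting the corresponding points and not containing any other vertex as an interior point; every pair of edges has finitely many intersection points, each of which is either a common vertex or a crossing point (where one edge passes from one side of the other to its other side). Two edges cross if they have a crossing point. Two edges are independent if they do not share a vertex. An edge is crossing-free if it crosses no other edge of the graph. *)

theory Defs
  imports "HOL-Analysis.Analysis"
begin

text \<open>g2 passes at parameter t from one side of g1 (at parameter s) to the other side:
  locally around the point p = g1 s = g2 t, the arc g1 can be straightened by a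
  homeomorphism h of a neighbourhood U of p onto the unit disc to a diameter, and g2
  goes from the lower half disc to the upper half disc (or vice versa).\<close>
definition crossing_at :: "(real \<Rightarrow> complex) \<Rightarrow> (real \<Rightarrow> complex) \<Rightarrow> real \<Rightarrow> real \<Rightarrow> bool" where
  "crossing_at g1 g2 s t \<longleftrightarrow>
     s \<in> {0<..<1} \<and> t \<in> {0<..<1} \<and> g1 s = g2 t \<and>
     (\<exists>U h h' \<delta>. open U \<and> g1 s \<in> U \<and> homeomorphism U (ball 0 1) h h' \<and> h (g1 s) = 0 \<and>
        h ` (U \<inter> path_image g1) = {z \<in> ball 0 1. Im z = 0} \<and>
        \<delta> > 0 \<and> {t - \<delta> .. t + \<delta>} \<subseteq> {0..1} \<and> g2 ` {t - \<delta> .. t + \<delta>} \<subseteq> U \<and>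
        (((\<forall>\<tau>\<in>{t - \<delta> ..< t}. Im (h (g2 \<tau>)) < 0) \<and> (\<forall>\<tau>\<in>{t <.. t + \<delta>}. Im (h (g2 \<tau>)) > 0)) \<or>
         ((\<forall>\<tau>\<in>{t - \<delta> ..< t}. Im (h (g2 \<tau>)) > 0) \<and> (\<forall>\<tau>\<in>{t <.. t + \<delta>}. Im (h (g2 \<tau>)) < 0))))"

definition crossing_point :: "(real \<Rightarrow> complex) \<Rightarrow> (real \<Rightarrow> complex) \<Rightarrow> complex \<Rightarrow> bool" where
  "crossing_point g1 g2 p \<longleftrightarrow>
     (\<exists>s t. g1 s = p \<and> (crossing_at g1 g2 s t \<or> crossing_at g2 g1 t s))"

definition topological_graph ::
  "complex set \<Rightarrow> complex set set \<Rightarrow> (complex set \<Rightarrow> real \<Rightarrow> complex) \<Rightarrow> bool" where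
  "topological_graph V E gam \<longleftrightarrow>
     finite V \<and>
     (\<forall>e\<in>E. e \<subseteq> V \<and> card e = 2) \<and>
     (\<forall>e\<in>E. arc (gam e) \<and> {pathstart (gam e), pathfinish (gam e)} = e \<and>
             (\<forall>v\<in>V. v \<in> path_image (gam e) \<longrightarrow> v \<in> e)) \<and>
     (\<forall>e\<in>E. \<forall>f\<in>E. e \<noteq> f \<longrightarrow>
        finite (path_image (gam e) \<inter> path_image (gam f)) \<and>
        (\<forall>p \<in> path_image (gam e) \<inter> path_image (gam f).
            p \<in> e \<inter> f \<or> crossing_point (gam e) (gam f) p))"

definition edges_cross :: "(complex set \<Rightarrow> real \<Rightarrow> complex) \<Rightarrow> complex set \<Rightarrow> complex set \<Rightarrow> bool" where
  "edges_cross gam e f \<longleftrightarrow> (\<exists>p. crossing_point (gam e) (gam f) p)"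

definition crossing_free :: "complex set set \<Rightarrow> (complex set \<Rightarrow> real \<Rightarrow> complex) \<Rightarrow> complex set \<Rightarrow> bool" where
  "crossing_free E gam e \<longleftrightarrow> (\<forall>f\<in>E. \<not> edges_cross gam e f)"

end

theory Submission
  imports Defs
begin

text \<open>
  The crossing-free edges \<open>F\<close> form a plane graph, so every vertex subset spans only linearly many
  of them; hence \<open>F\<close> is \<open>10\<close>-degenerate and has an orientation with out-neighbourhoods \<open>N v\<close> of
  size at most \<open>10\<close>. Take a random \<open>T \<subseteq> V\<close> and keep those edges outside \<open>F\<close> that have both endpoints
  in \<open>T\<close> and no out-neighbour of an endpoint in \<open>T\<close>. No edge of \<open>F\<close> joins endpoints of kept edges, so
  these do not cross and there are linearly many, while each edge is kept with probability at least
  \<open>2\<^sup>-\<^sup>2\<^sup>2\<close>.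

  The bound for plane graphs comes from the inequality \<open>E + c \<le> f + V\<close> in Euler's formula (with \<open>f\<close>
  faces and \<open>c\<close> connected components): by the Jordan curve theorem an edge closing a cycle splits a face. Every
  face is incident to at least three edges, because two arcs of a simple graph do not separate the
  plane, and an edge that is not a bridge is incident to at most two faces.
\<close>

section \<open>Components of the complement of a closed set with an arc attached\<close>

lemma componentsI_maximal:
  assumes "C \<noteq> {}" "C \<subseteq> S" "connected C"
    and "\<And>T. connected T \<Longrightarrow> T \<subseteq> S \<Longrightarrow> C \<subseteq> T \<Longrightarrow> T \<subseteq> C"
  shows "C \<in> components S"
  using assms by (subst in_components_maximal) blast

text \<open>Attaching \<open>A\<close> inside one face \<open>D\<close> leaves every other member of
  \<open>\<F>\<close> a component, and the points of \<open>P\<close>, pairwise separated by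
  \<open>X \<union> A\<close>, represent distinct new components inside \<open>D\<close>. The
  \<open>+ 1\<close> pays for the possible loss of \<open>D\<close>.\<close>

lemma components_refine:
  assumes D: "D \<in> components (- X)" and A: "A \<subseteq> D" and fin: "finite \<F>" "\<F> \<subseteq> components (- X)"
    and P: "finite P" "P \<subseteq> D - A"
    and sep: "\<And>a b. a \<in> P \<Longrightarrow> b \<in> P \<Longrightarrow> connected_component (- (X \<union> A)) a b \<Longrightarrow> a = b"
  obtains \<F>' where "finite \<F>'" "\<F>' \<subseteq> components (- (X \<union> A))" "card \<F> + card P \<le> card \<F>' + 1"
proof
  let ?c = "connected_component_set (- (X \<union> A))"
  let ?F = "(\<F> - {D}) \<union> ?c ` P"
  have PX: "P \<subseteq> - (X \<union> A)"
    using P D in_components_subset by blast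
  have cD: "?c a \<subseteq> D" if "a \<in> P" for a
  proof (rule components_maximal[OF D])
    show "connected (?c a)" by simp
    show "?c a \<subseteq> - X" using connected_component_subset by blast
    have "a \<in> ?c a" using PX that by auto
    then show "D \<inter> ?c a \<noteq> {}" using P that by blast
  qed
  show "finite ?F" using fin P by simp
  show "?F \<subseteq> components (- (X \<union> A))"
  proof (intro Un_least subsetI)
    fix W assume W: "W \<in> \<F> - {D}"
    then have WX: "W \<in> components (- X)" using fin by blast
    have "W \<inter> D = {}" using W WX D components_nonoverlap by blast
    show "W \<in> components (- (X \<union> A))"
    proof (rule componentsI_maximal)
      show "W \<noteq> {}" "connected W" using WX in_components_nonempty in_components_connected by blast+
      show "W \<subseteq> - (X \<union> A)" using in_components_subset[OF WX] A \<open>W \<inter> D = {}\<close> by blast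
      show "T \<subseteq> W" if "connected T" "T \<subseteq> - (X \<union> A)" "W \<subseteq> T" for T
        using components_maximal[OF WX, of T] that \<open>W \<noteq> {}\<close> by blast
    qed
  next
    fix W assume "W \<in> ?c ` P"
    then show "W \<in> components (- (X \<union> A))" using PX by (auto simp: components_def)
  qed
  have inj: "inj_on ?c P"
  proof (rule inj_onI)
    fix a b assume ab: "a \<in> P" "b \<in> P" "?c a = ?c b"
    have "b \<in> ?c b" using PX ab by auto
    then have "b \<in> ?c a" using ab by simp
    then show "a = b" using sep ab by simp
  qed
  have disj: "(\<F> - {D}) \<inter> ?c ` P = {}"
  proof (rule ccontr)
    assume "\<not> ?thesis"
    then obtain a where a: "a \<in> P" "?c a \<in> \<F>" "?c a \<noteq> D" by blast
    have "a \<in> ?c a" using PX a by auto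
    then have "?c a \<inter> D \<noteq> {}" using a P by blast
    then show False using a fin D components_nonoverlap by blast
  qed
  have "card ?F = card (\<F> - {D}) + card P"
    using disj fin P inj by (simp add: card_Un_disjoint card_image)
  moreover have "card \<F> \<le> card (\<F> - {D}) + 1"
    using fin diff_card_le_card_Diff[of "{D}" \<F>] by simp
  ultimately show "card \<F> + card P \<le> card ?F + 1" by linarith
qed

text \<open>A single arc does not separate the plane; for two arcs with connected intersection this
  is Janiszewski's theorem.\<close>

lemma connected_Compl_arcs:
  fixes A :: "(real \<Rightarrow> complex) set"
  assumes "finite A" "card A \<le> 2" "\<And>g. g \<in> A \<Longrightarrow> arc g"
    and conn: "\<And>g h. g \<in> A \<Longrightarrow> h \<in> A \<Longrightarrow> g \<noteq> h \<Longrightarrow> connected (path_image g \<inter> path_image h)"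
  shows "connected (- (\<Union>g\<in>A. path_image g))"
proof -
  have "card A = 0 \<or> card A = 1 \<or> card A = 2" using assms by linarith
  then consider "A = {}" | g where "A = {g}" | g h where "A = {g, h}" "g \<noteq> h"
    using assms(1) by (auto simp: card_1_singleton_iff card_2_iff)
  then show ?thesis
  proof cases
    case 2
    then show ?thesis using assms by (simp add: connected_arc_complement)
  next
    case 3
    then have "connected (- (path_image g \<union> path_image h))"
      using assms by (intro Janiszewski_connected)
        (auto simp: compact_arc_image closed_arc_image connected_arc_complement)
    then show ?thesis using 3 by simp
  qed (simp add: connected_UNIV)
qed

text \<open>Pigeonhole: a Jordan curve has two complementary regions, so two of the three points
  share one.\<close>

lemma simple_loop_complement_cases:
  fixes c :: "real \<Rightarrow> complex"
  assumes "simple_path c" "pathfinish c = pathstart c" "{x, y, z} \<subseteq> - path_image c"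
  shows "connected_component (- path_image c) x y \<or> connected_component (- path_image c) y z \<or>
         connected_component (- path_image c) x z"
proof -
  let ?I = "inside (path_image c)" and ?O = "outside (path_image c)"
  note J = Jordan_inside_outside[OF assms(1,2)]
  have I: "connected_component (- path_image c) a b" if "a \<in> ?I" "b \<in> ?I" for a b
    unfolding connected_component_def by (rule exI[of _ ?I]) (use J that in blast)
  have O: "connected_component (- path_image c) a b" if "a \<in> ?O" "b \<in> ?O" for a b
    unfolding connected_component_def by (rule exI[of _ ?O]) (use J that in blast)
  have "{x, y, z} \<subseteq> ?I \<union> ?O" using J assms by blast
  then show ?thesis using I O by blast
qed

text \<open>If it were open, its frontier would lie in the two endpoints. The plane without these is
  connected, so the arc would fill the whole plane, which is unbounded. Hence an edge never exhausts
  the open face in which it is drawn.\<close>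

lemma arc_endless_not_open:
  fixes g :: "real \<Rightarrow> complex"
  assumes "arc g"
  shows "\<not> open (path_image g - {pathstart g, pathfinish g})"
proof
  let ?A = "path_image g - {pathstart g, pathfinish g}"
  let ?S = "- {pathstart g, pathfinish g} :: complex set"
  assume op: "open ?A"
  have "connected (UNIV - {pathstart g, pathfinish g} :: complex set)"
    by (rule connected_open_delete_finite) auto
  then have S: "connected ?S" by (simp add: Compl_eq_Diff_UNIV)
  have ne: "?A \<noteq> {}" using nonempty_simple_path_endless[OF arc_imp_simple_path[OF assms]] .
  have "closure ?A \<subseteq> path_image g"
    by (rule closure_minimal) (auto simp: closed_arc_image assms)
  moreover have "frontier ?A = closure ?A - ?A" using op by (simp add: frontier_def interior_open)
  ultimately have "?S \<inter> frontier ?A = {}" by blast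
  then have "?S - ?A = {}" using connected_Int_frontier[OF S, of ?A] ne by blast
  then have "UNIV \<subseteq> path_image g"
    by (auto simp: set_eq_iff) (metis pathstart_in_path_image pathfinish_in_path_image)
  then have "bounded (UNIV :: complex set)"
    using bounded_arc_image[OF assms] bounded_subset by blast
  then show False by simp
qed

section \<open>Plane drawings\<close>

definition plane_drawing ::
  "complex set \<Rightarrow> complex set set \<Rightarrow> (complex set \<Rightarrow> real \<Rightarrow> complex) \<Rightarrow> bool" where
  "plane_drawing V E gam \<longleftrightarrow>
     finite V \<and>
     (\<forall>e\<in>E. e \<subseteq> V \<and> card e = 2 \<and> arc (gam e) \<and>
        {pathstart (gam e), pathfinish (gam e)} = e \<and> path_image (gam e) \<inter> V \<subseteq> e) \<and>
     (\<forall>e\<in>E. \<forall>f\<in>E. e \<noteq> f \<longrightarrow> path_image (gam e) \<inter> path_image (gam f) \<subseteq> e \<inter> f)"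

definition carrier ::
  "complex set \<Rightarrow> complex set set \<Rightarrow> (complex set \<Rightarrow> real \<Rightarrow> complex) \<Rightarrow> complex set" where
  "carrier V E gam = V \<union> (\<Union>e\<in>E. path_image (gam e))"

definition open_edge :: "(complex set \<Rightarrow> real \<Rightarrow> complex) \<Rightarrow> complex set \<Rightarrow> complex set" where
  "open_edge gam e = path_image (gam e) - e"

section \<open>Connected components of the abstract graph\<close>

definition linked :: "'a set set \<Rightarrow> ('a \<times> 'a) set" where
  "linked E = {(x, y). {x, y} \<in> E}\<^sup>*"

text \<open>The number of connected components, counted as classes of \<open>linked E\<close>.
  Reflexivity of the closure makes each isolated vertex a class of its own.\<close>

definition ncomp :: "'a set \<Rightarrow> 'a set set \<Rightarrow> nat" where
  "ncomp V E = card ((\<lambda>v. linked E `` {v}) ` V)"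

lemma linked_mono: "E \<subseteq> E' \<Longrightarrow> linked E \<subseteq> linked E'"
  unfolding linked_def by (rule rtrancl_mono) auto

lemma sym_linked: "sym (linked E)"
  unfolding linked_def by (rule sym_rtrancl) (auto simp: sym_def insert_commute)

lemma trans_linked: "trans (linked E)"
  unfolding linked_def by (rule trans_rtrancl)

lemma linked_Image_eq:
  assumes "(x, y) \<in> linked E"
  shows "linked E `` {x} = linked E `` {y}"
  using assms sym_linked[of E] trans_linked[of E] by (blast dest: symD transD)

lemma ncomp_le_card: "finite V \<Longrightarrow> ncomp V E \<le> card V"
  unfolding ncomp_def by (rule card_image_le)

lemma linked_classes_mono:
  assumes "E \<subseteq> E'"
  shows "(\<lambda>v. linked E' `` {v}) ` V = (\<lambda>C. linked E' `` C) ` (\<lambda>v. linked E `` {v}) ` V"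
proof -
  have "linked E' `` (linked E `` {v}) = linked E' `` {v}" for v
  proof
    show "linked E' `` (linked E `` {v}) \<subseteq> linked E' `` {v}"
      using linked_mono[OF assms] trans_linked[of E'] by (blast dest: transD)
    have "(v, v) \<in> linked E" by (simp add: linked_def)
    then show "linked E' `` {v} \<subseteq> linked E' `` (linked E `` {v})" by blast
  qed
  then show ?thesis by (simp add: image_image)
qed

lemma ncomp_antimono:
  assumes "finite V" "E \<subseteq> E'"
  shows "ncomp V E' \<le> ncomp V E"
  unfolding ncomp_def linked_classes_mono[OF assms(2), of V]
  using assms(1) by (intro card_image_le) simp

text \<open>The surjection from old to new classes identifies the classes of \<open>u\<close> and
  \<open>v\<close>, which were distinct; not being injective, it strictly lowers the count.\<close>

lemma ncomp_insert_bridge: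
  assumes "finite V" "u \<in> V" "v \<in> V" "(u, v) \<notin> linked E"
  shows "ncomp V (insert {u, v} E) < ncomp V E"
proof -
  let ?E' = "insert {u, v} E"
  let ?f = "\<lambda>C. linked ?E' `` C" and ?cls = "\<lambda>v. linked E `` {v}"
  have "(u, v) \<in> linked ?E'" unfolding linked_def by auto
  then have "linked ?E' `` {u} = linked ?E' `` {v}" by (rule linked_Image_eq)
  moreover have "?f (?cls w) = linked ?E' `` {w}" for w
    using linked_classes_mono[of E ?E' "{w}"] by auto
  ultimately have eq: "?f (?cls u) = ?f (?cls v)" by simp
  have "(v, v) \<in> linked E" by (simp add: linked_def)
  then have ne: "?cls u \<noteq> ?cls v" using assms(4) by blast
  have "\<not> inj_on ?f (?cls ` V)" using eq ne assms(2,3) by (meson imageI inj_onD)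
  then have "card (?f ` ?cls ` V) \<noteq> card (?cls ` V)"
    using eq_card_imp_inj_on[of "?cls ` V" ?f] assms(1) by blast
  moreover have "card (?f ` ?cls ` V) \<le> card (?cls ` V)" using assms(1) by (intro card_image_le) simp
  moreover have "(\<lambda>w. linked ?E' `` {w}) ` V = ?f ` ?cls ` V" by (rule linked_classes_mono) blast
  ultimately show ?thesis unfolding ncomp_def by simp
qed

lemma plane_drawing_mono: "plane_drawing V E gam \<Longrightarrow> E' \<subseteq> E \<Longrightarrow> plane_drawing V E' gam"
  unfolding plane_drawing_def by (meson subsetD)

lemma plane_drawingD:
  assumes "plane_drawing V E gam" "e \<in> E"
  shows "e \<subseteq> V" "card e = 2" "arc (gam e)" "{pathstart (gam e), pathfinish (gam e)} = e"
    "path_image (gam e) \<inter> V = e"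
proof -
  have *: "e \<subseteq> V \<and> card e = 2 \<and> arc (gam e) \<and>
      {pathstart (gam e), pathfinish (gam e)} = e \<and> path_image (gam e) \<inter> V \<subseteq> e"
    using assms by (simp add: plane_drawing_def)
  then show "e \<subseteq> V" "card e = 2" "arc (gam e)" and ends: "{pathstart (gam e), pathfinish (gam e)} = e"
    by simp_all
  have "{pathstart (gam e), pathfinish (gam e)} \<subseteq> path_image (gam e)"
    by (simp add: pathstart_in_path_image pathfinish_in_path_image)
  then have "e \<subseteq> path_image (gam e)" unfolding ends .
  then show "path_image (gam e) \<inter> V = e" using * by fast
qed

lemma plane_drawing_finite:
  assumes "plane_drawing V E gam"
  shows "finite V" "finite E"
proof -
  show "finite V" using assms by (simp add: plane_drawing_def)
  then show "finite E" using plane_drawingD(1)[OF assms]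
    by (intro finite_subset[of E "Pow V"]) auto
qed

section \<open>The point set of a drawing, and loops through an edge\<close>

lemma compact_carrier:
  assumes "plane_drawing V E gam"
  shows "compact (carrier V E gam)"
  unfolding carrier_def using plane_drawing_finite[OF assms] plane_drawingD(3)[OF assms]
  by (intro compact_Un compact_UN) (auto simp: finite_imp_compact compact_arc_image)

lemma carrier_insert:
  assumes "plane_drawing V (insert e E) gam"
  shows "carrier V (insert e E) gam = carrier V E gam \<union> open_edge gam e"
    "carrier V (insert e E) gam = carrier V E gam \<union> path_image (gam e)"
  using plane_drawingD(1)[OF assms, of e] by (auto simp: carrier_def open_edge_def)

lemma carrier_Int_edge:
  assumes "plane_drawing V (insert e E) gam" "e \<notin> E"
  shows "carrier V E gam \<inter> path_image (gam e) = e"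
proof
  have "path_image (gam f) \<inter> path_image (gam e) \<subseteq> e" if "f \<in> E" for f
    using assms that unfolding plane_drawing_def by (metis inf.bounded_iff insertCI)
  then show "carrier V E gam \<inter> path_image (gam e) \<subseteq> e"
    using plane_drawingD(5)[OF assms(1), of e] by (auto simp: carrier_def)
  show "e \<subseteq> carrier V E gam \<inter> path_image (gam e)"
    using plane_drawingD(1,5)[OF assms(1), of e] by (auto simp: carrier_def)
qed

lemma carrier_Int_open_edge:
  assumes "plane_drawing V (insert e E) gam" "e \<notin> E"
  shows "carrier V E gam \<inter> open_edge gam e = {}"
  using carrier_Int_edge[OF assms] by (auto simp: open_edge_def)

lemma open_edge_props:
  assumes "plane_drawing V E gam" "e \<in> E"
  shows "connected (open_edge gam e)" "open_edge gam e \<noteq> {}" "\<not> open (open_edge gam e)"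
proof -
  note d = plane_drawingD[OF assms]
  have *: "open_edge gam e = path_image (gam e) - {pathstart (gam e), pathfinish (gam e)}"
    unfolding open_edge_def d(4) ..
  show "connected (open_edge gam e)" "open_edge gam e \<noteq> {}" "\<not> open (open_edge gam e)"
    unfolding * using d(3) by (simp_all only: connected_simple_path_endless
      nonempty_simple_path_endless arc_endless_not_open arc_imp_simple_path not_False_eq_True)
qed

lemma linked_path_component:
  assumes "plane_drawing V E gam" "(u, v) \<in> linked E" "u \<in> V"
  shows "path_component (carrier V E gam) u v"
  using assms(2) unfolding linked_def
proof (induction rule: rtrancl_induct)
  case base
  then show ?case using assms(3) by (simp add: path_component_refl carrier_def)
next
  case (step y z)
  let ?e = "{y, z}"
  have e: "?e \<in> E" using step by simp
  note d = plane_drawingD[OF assms(1) e]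
  have im: "path_image (gam ?e) \<subseteq> carrier V E gam" using e by (auto simp: carrier_def)
  have "path_connected (path_image (gam ?e))" using d(3) by (simp add: arc_imp_path path_connected_path_image)
  then have "path_component (path_image (gam ?e)) y z"
    using d(5) by (auto simp: path_connected_component)
  then show ?case using step.IH im path_component_of_subset path_component_trans by blast
qed

text \<open>The rest of the drawing joins the ends of the edge, so it contains an arc
  \<open>q\<close> between them that closes the edge to a Jordan curve. The curve meets the rest
  exactly in \<open>q\<close>; this connected intersection is what Janiszewski's theorem asks
  for.\<close>

lemma linked_edge_loop:
  assumes pd: "plane_drawing V (insert {u, v} E) gam" and e: "{u, v} \<notin> E" and l: "(u, v) \<in> linked E"
  obtains c where "simple_path c" "pathfinish c = pathstart c"
    "carrier V E gam \<union> path_image c = carrier V (insert {u, v} E) gam"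
    "open_edge gam {u, v} \<subseteq> path_image c" "connected (carrier V E gam \<inter> path_image c)"
proof -
  let ?e = "{u, v}" and ?X = "carrier V E gam"
  note d = plane_drawingD[OF pd insertI1]
  define g where "g = gam ?e"
  define s t where "s = pathstart g" and "t = pathfinish g"
  have st: "{s, t} = ?e" using d(4) by (simp add: g_def s_def t_def)
  have ag: "arc g" using d(3) by (simp add: g_def)
  have "s \<noteq> t" using arc_distinct_ends[OF ag] by (simp add: s_def t_def)
  have "(v, u) \<in> linked E" using l sym_linked[of E] by (blast dest: symD)
  then have "(t, s) \<in> linked E" using l st by (auto simp: doubleton_eq_iff)
  moreover have "t \<in> V" using st d(1) by blast
  ultimately have "path_component ?X t s"
    using linked_path_component plane_drawing_mono[OF pd] by blast
  then obtain p where p: "path p" "path_image p \<subseteq> ?X" "pathstart p = t" "pathfinish p = s"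
    unfolding path_component_def by blast
  obtain q where q: "arc q" "path_image q \<subseteq> path_image p" "pathstart q = t" "pathfinish q = s"
    using path_contains_arc[OF p(1,3,4)] \<open>s \<noteq> t\<close> by blast
  have qX: "path_image q \<subseteq> ?X" using p q by blast
  have Xg: "?X \<inter> path_image g = {s, t}" using carrier_Int_edge[OF pd e] st by (simp add: g_def)
  have stq: "{s, t} \<subseteq> path_image q"
    using q pathstart_in_path_image[of q] pathfinish_in_path_image[of q] by simp
  have im: "path_image (g +++ q) = path_image g \<union> path_image q"
    using q by (simp add: path_image_join t_def)
  show thesis
  proof (rule that[of "g +++ q"])
    show "simple_path (g +++ q)"
      using ag q qX Xg by (intro simple_path_join_loop) (auto simp: s_def t_def)
    show "pathfinish (g +++ q) = pathstart (g +++ q)" using q by (simp add: s_def)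
    show "?X \<union> path_image (g +++ q) = carrier V (insert ?e E) gam"
      using carrier_insert(2)[OF pd] qX im by (auto simp: g_def)
    show "open_edge gam ?e \<subseteq> path_image (g +++ q)" using im by (auto simp: open_edge_def g_def)
    have "?X \<inter> path_image (g +++ q) = path_image q" using im qX Xg stq by blast
    then show "connected (?X \<inter> path_image (g +++ q))" using q by (simp add: connected_arc_image)
  qed
qed

section \<open>Faces of a plane drawing\<close>

lemma card2_obtain:
  assumes "card e = 2"
  obtains u v where "e = {u, v}" "u \<noteq> v"
  using assms by (auto simp: card_2_iff)

lemma open_edge_in_face:
  assumes pd: "plane_drawing V (insert e E) gam" "e \<notin> E"
  obtains D where "D \<in> components (- carrier V E gam)" "open_edge gam e \<subseteq> D" "open D"
proof -
  note i = open_edge_props[OF pd(1) insertI1]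
  have sub: "open_edge gam e \<subseteq> - carrier V E gam" using carrier_Int_open_edge[OF pd] by blast
  then have "- carrier V E gam \<noteq> {}" using i by blast
  then obtain D where D: "D \<in> components (- carrier V E gam)" "open_edge gam e \<subseteq> D"
    using exists_component_superset[OF sub _ i(1)] by blast
  have "open (- carrier V E gam)"
    using compact_carrier[OF plane_drawing_mono[OF pd(1) subset_insertI]] by (simp add: compact_imp_closed open_Compl)
  then show thesis using that D open_components by blast
qed

text \<open>Induction on the edges. An edge within a component splits a face and does not raise
  \<open>ncomp\<close>; an edge between two components lowers \<open>ncomp\<close> and loses no
  face. A finite family \<open>\<F>\<close> witnesses a lower bound on the number of faces.\<close>

lemma Euler_lower_bound:
  assumes "plane_drawing V E gam"
  shows "\<exists>\<F>. finite \<F> \<and> \<F> \<subseteq> components (- carrier V E gam) \<and>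
    card E + ncomp V E \<le> card \<F> + card V"
  using plane_drawing_finite(2)[OF assms] assms
proof (induction E)
  case empty
  then show ?case
    using ncomp_le_card[OF plane_drawing_finite(1)] by (intro exI[of _ "{}"]) simp
next
  case (insert e E)
  let ?X = "carrier V E gam" and ?A = "open_edge gam e"
  note pd = insert.prems
  have finV: "finite V" by (rule plane_drawing_finite(1)[OF pd])
  have "plane_drawing V E gam" by (rule plane_drawing_mono[OF pd]) blast
  then obtain \<F> where F: "finite \<F>" "\<F> \<subseteq> components (- ?X)" "card E + ncomp V E \<le> card \<F> + card V"
    using insert.IH by blast
  note d = plane_drawingD[OF pd insertI1]
  obtain u v where uv: "e = {u, v}" using d(2) by (rule card2_obtain)
  have uvV: "u \<in> V" "v \<in> V" using d(1) uv by auto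
  obtain D where D: "D \<in> components (- ?X)" "?A \<subseteq> D" "open D"
    using open_edge_in_face[OF pd insert.hyps(2)] by blast
  have carr: "carrier V (insert e E) gam = ?X \<union> ?A" by (rule carrier_insert(1)[OF pd])
  have cardE: "card (insert e E) = card E + 1" using insert.hyps by simp
  show ?case
  proof (cases "(u, v) \<in> linked E")
    case True
    obtain c where c: "simple_path c" "pathfinish c = pathstart c"
      "?X \<union> path_image c = carrier V (insert {u, v} E) gam" "open_edge gam {u, v} \<subseteq> path_image c"
      "connected (?X \<inter> path_image c)"
      by (rule linked_edge_loop[OF pd[unfolded uv] insert.hyps(2)[unfolded uv] True])
    note J = Jordan_inside_outside[OF c(1,2)]
    obtain p where p: "p \<in> ?A" using open_edge_props(2)[OF pd insertI1] by blast
    then have pc: "p \<in> path_image c" using c(4) uv by blast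
    \<comment> \<open>Every point of a Jordan curve is a boundary point of both sides, so the open
      neighbourhood \<open>D\<close> of \<open>p\<close> meets both.\<close>
    have "p \<in> closure (inside (path_image c))" "p \<in> closure (outside (path_image c))"
      using J pc by (auto simp: frontier_def)
    then have "D \<inter> inside (path_image c) \<noteq> {}" "D \<inter> outside (path_image c) \<noteq> {}"
      using open_Int_closure_eq_empty[OF D(3)] D(2) p by blast+
    then obtain a b where a: "a \<in> D" "a \<in> inside (path_image c)"
      and b: "b \<in> D" "b \<in> outside (path_image c)" by blast
    have "a \<notin> ?A" "b \<notin> ?A" using a b J c(4) uv by blast+
    have nab: "\<not> connected_component (- (?X \<union> ?A)) x y"
      if "x \<in> inside (path_image c)" "y \<in> outside (path_image c)" for x y
    proof
      assume "connected_component (- (?X \<union> ?A)) x y"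
      moreover have "path_image c \<subseteq> ?X \<union> ?A" using c(3) carr uv by blast
      ultimately have "connected_component (- path_image c) x y"
        using connected_component_of_subset by blast
      then have "y \<in> inside (path_image c)" using that inside_same_component by blast
      then show False using J that by blast
    qed
    have "a \<noteq> b" using a b J by blast
    obtain \<F>' where F': "finite \<F>'" "\<F>' \<subseteq> components (- (?X \<union> ?A))"
        "card \<F> + card {a, b} \<le> card \<F>' + 1"
    proof (rule components_refine[OF D(1,2) F(1,2), of "{a, b}"])
      show "{a, b} \<subseteq> D - ?A" using a b \<open>a \<notin> ?A\<close> \<open>b \<notin> ?A\<close> by blast
      show "x = y" if "x \<in> {a, b}" "y \<in> {a, b}" "connected_component (- (?X \<union> ?A)) x y" for x y
        using that nab[OF a(2) b(2)] connected_component_sym by auto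
    qed auto
    have "ncomp V (insert e E) \<le> ncomp V E" by (rule ncomp_antimono[OF finV]) blast
    then show ?thesis using F' F(3) \<open>a \<noteq> b\<close> cardE carr by (intro exI[of _ \<F>']) auto
  next
    case False
    \<comment> \<open>Some point of \<open>D\<close> lies off the new edge; it represents one
      surviving face in place of \<open>D\<close>.\<close>
    have "D \<noteq> ?A" using D(3) open_edge_props(3)[OF pd insertI1] by blast
    then obtain a where a: "a \<in> D - ?A" using D(2) by blast
    obtain \<F>' where F': "finite \<F>'" "\<F>' \<subseteq> components (- (?X \<union> ?A))"
        "card \<F> + card {a} \<le> card \<F>' + 1"
      by (rule components_refine[OF D(1,2) F(1,2), of "{a}"]) (use a in auto)
    have "ncomp V (insert e E) < ncomp V E"
      using ncomp_insert_bridge[OF finV uvV False] uv by simp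
    then show ?thesis using F' F(3) cardE carr by (intro exI[of _ \<F>']) auto
  qed
qed

section \<open>Incidences between faces and edges\<close>

lemma connected_component_components_eq:
  assumes "connected_component S a b" "W \<in> components S" "W' \<in> components S" "a \<in> W" "b \<in> W'"
  shows "W = W'"
  using assms joinable_components_eq unfolding connected_component_def by blast

text \<open>Two faces at \<open>e\<close> on the same side of a loop through \<open>e\<close> are joined both off the remaining
  drawing and off the loop, hence off their union by Janiszewski's theorem.\<close>

lemma three_faces_at_edge:
  assumes pd: "plane_drawing V (insert {u, v} E) gam" "{u, v} \<notin> E" and l: "(u, v) \<in> linked E"
    and W: "\<And>i. i < 3 \<Longrightarrow> W i \<in> components (- carrier V (insert {u, v} E) gam)"
    and inc: "\<And>i::nat. i < 3 \<Longrightarrow> closure (W i) \<inter> open_edge gam {u, v} \<noteq> {}"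
  shows "W 0 = W 1 \<or> W 1 = W 2 \<or> W 0 = W 2"
proof -
  let ?X = "carrier V E gam" and ?A = "open_edge gam {u, v}"
  obtain D where D: "D \<in> components (- ?X)" "?A \<subseteq> D" "open D"
    using open_edge_in_face[OF pd] by blast
  obtain c where c: "simple_path c" "pathfinish c = pathstart c"
      "?X \<union> path_image c = carrier V (insert {u, v} E) gam"
      "open_edge gam {u, v} \<subseteq> path_image c" "connected (?X \<inter> path_image c)"
    by (rule linked_edge_loop[OF pd l])
  \<comment> \<open>\<open>D\<close> is an open neighbourhood of the open edge, so a face whose
    closure reaches the edge has a point in \<open>D\<close>.\<close>
  have "D \<inter> W i \<noteq> {}" if "i < 3" for i
    using inc[OF that] open_Int_closure_eq_empty[OF D(3), of "W i"] D(2) by blast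
  then have "\<forall>i. \<exists>w. i < 3 \<longrightarrow> w \<in> D \<inter> W i" by blast
  then obtain w where w: "\<And>i. i < 3 \<Longrightarrow> w i \<in> D \<inter> W i" by metis
  have same: "W i = W j" if ij: "i < 3" "j < 3" "connected_component (- path_image c) (w i) (w j)" for i j
  proof -
    have "connected_component (- ?X) (w i) (w j)"
      unfolding connected_component_def using w ij D(1) in_components_connected in_components_subset by blast
    moreover have "compact ?X" by (rule compact_carrier[OF plane_drawing_mono[OF pd(1)]]) blast
    moreover have "closed (path_image c)" using c(1) by (rule closed_simple_path_image)
    ultimately have "connected_component (- (?X \<union> path_image c)) (w i) (w j)"
      using Janiszewski c(5) ij(3) by blast
    then show ?thesis
      unfolding c(3) using connected_component_components_eq W w ij by blast
  qed
  have "w i \<in> - path_image c" if "i < 3" for i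
    using w[OF that] in_components_subset[OF W[OF that]] c(3) by blast
  then have "{w 0, w 1, w 2} \<subseteq> - path_image c" by simp
  from simple_loop_complement_cases[OF c(1,2) this] show ?thesis
    using same[of 0 1] same[of 1 2] same[of 0 2] by auto
qed

lemma card_faces_at_edge:
  assumes pd: "plane_drawing V (insert {u, v} E) gam" "{u, v} \<notin> E" and l: "(u, v) \<in> linked E"
    and F: "finite \<F>" "\<F> \<subseteq> components (- carrier V (insert {u, v} E) gam)"
  shows "card {W \<in> \<F>. closure W \<inter> open_edge gam {u, v} \<noteq> {}} \<le> 2"
proof (rule ccontr)
  let ?B = "{W \<in> \<F>. closure W \<inter> open_edge gam {u, v} \<noteq> {}}"
  assume "\<not> ?thesis"
  then obtain T where T: "T \<subseteq> ?B" "card T = 3"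
    using obtain_subset_with_card_n[of 3 ?B] by auto
  then obtain W0 W1 W2 where W: "T = {W0, W1, W2}" "W0 \<noteq> W1" "W1 \<noteq> W2" "W0 \<noteq> W2"
    by (auto simp: card_3_iff)
  define W where "W i = (if i = 0 then W0 else if i = 1 then W1 else W2)" for i :: nat
  have "W i \<in> ?B" for i using T(1) W(1) unfolding W_def by auto
  then have "W 0 = W 1 \<or> W 1 = W 2 \<or> W 0 = W 2"
    using F(2) by (intro three_faces_at_edge[OF pd l]) auto
  then show False using W by (simp add: W_def)
qed

text \<open>Suppose that \<open>W\<close> touches only the at most two edges in \<open>I\<close>.
  Their arcs leave a connected complement \<open>S\<close>, still connected without the vertices,
  and \<open>W\<close> has no frontier point in \<open>S - V\<close>. So \<open>W\<close> contains
  \<open>S - V\<close>, and with it the interior of a third edge, although faces avoid the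
  drawing.\<close>

lemma card_edges_at_face:
  assumes pd: "plane_drawing V E gam" and W: "W \<in> components (- carrier V E gam)" and "3 \<le> card E"
  shows "3 \<le> card {e \<in> E. closure W \<inter> open_edge gam e \<noteq> {}}"
proof (rule ccontr)
  let ?K = "carrier V E gam"
  define I where "I = {e \<in> E. closure W \<inter> open_edge gam e \<noteq> {}}"
  assume "\<not> ?thesis"
  then have cI: "card I \<le> 2" by (simp add: I_def)
  note fin = plane_drawing_finite[OF pd]
  have finI: "finite I" and IE: "I \<subseteq> E" using fin by (auto simp: I_def)
  have meet: "path_image (gam e) \<inter> path_image (gam f) \<subseteq> e \<inter> f" if "e \<in> E" "f \<in> E" "e \<noteq> f" for e f
    using pd that by (simp add: plane_drawing_def)
  define S where "S = - (\<Union>g \<in> gam ` I. path_image g)"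
  have "connected S" unfolding S_def
  proof (rule connected_Compl_arcs)
    show "finite (gam ` I)" using finI by simp
    show "card (gam ` I) \<le> 2" using card_image_le[OF finI] cI by (rule le_trans)
    show "arc g" if "g \<in> gam ` I" for g using that IE plane_drawingD(3)[OF pd] by blast
    show "connected (path_image g \<inter> path_image h)" if gh: "g \<in> gam ` I" "h \<in> gam ` I" "g \<noteq> h" for g h
    proof -
      obtain e f where ef: "g = gam e" "h = gam f" "e \<in> E" "f \<in> E" "e \<noteq> f" using gh IE by blast
      obtain a b where e: "e = {a, b}" using plane_drawingD(2)[OF pd ef(3)] by (rule card2_obtain)
      \<comment> \<open>Simplicity of the graph enters here: distinct edges share at most one end,
        so their arcs meet in at most one point.\<close>
      have "e \<inter> f \<noteq> e"
      proof
        assume "e \<inter> f = e"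
        moreover have "card e = 2" "card f = 2" "finite f"
          using plane_drawingD(1,2)[OF pd] ef fin(1) finite_subset by blast+
        ultimately have "e = f" by (metis card_subset_eq inf.orderI)
        then show False using ef by simp
      qed
      then have "e \<inter> f \<subseteq> {a} \<or> e \<inter> f \<subseteq> {b}" using e by auto
      then have "\<exists>x. path_image g \<inter> path_image h \<subseteq> {x}" using meet[OF ef(3-5)] ef(1,2) by blast
      then show ?thesis by (metis connected_empty connected_sing subset_singleton_iff)
    qed
  qed
  moreover have "open S" unfolding S_def open_closed double_complement
    using finI IE plane_drawingD(3)[OF pd] closed_arc_image by (intro closed_UN) auto
  ultimately have conn: "connected (S - V)"
    using fin by (intro connected_open_delete_finite) auto
  have WK: "W \<subseteq> - ?K" "W \<noteq> {}" using in_components_subset[OF W] in_components_nonempty[OF W] .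
  have "W \<subseteq> S - V" using WK IE by (auto simp: S_def carrier_def)
  moreover have "(S - V) \<inter> frontier W = {}"
  proof (rule ccontr)
    assume "\<not> ?thesis"
    then obtain x where x: "x \<in> S" "x \<notin> V" "x \<in> frontier W" by blast
    have "frontier W \<subseteq> ?K"
      using frontier_of_components_closed_complement[OF _ W] compact_carrier[OF pd] compact_imp_closed
      by blast
    then obtain e where e: "e \<in> E" "x \<in> path_image (gam e)" using x by (auto simp: carrier_def)
    then have "x \<in> open_edge gam e" using x(2) plane_drawingD(1)[OF pd e(1)] by (auto simp: open_edge_def)
    moreover have "x \<in> closure W" using x(3) by (simp add: frontier_def)
    ultimately have "e \<in> I" using e(1) by (auto simp: I_def)
    then show False using x(1) e(2) by (auto simp: S_def)
  qed
  ultimately have SW: "S - V \<subseteq> W" using connected_Int_frontier[OF conn, of W] WK(2) by blast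
  have "\<not> E \<subseteq> I" using card_mono[OF finI, of E] cI \<open>3 \<le> card E\<close> by linarith
  then obtain e where e: "e \<in> E" "e \<notin> I" by blast
  obtain x where x: "x \<in> open_edge gam e" using open_edge_props(2)[OF pd e(1)] by blast
  then have xe: "x \<in> path_image (gam e)" "x \<notin> e" by (auto simp: open_edge_def)
  have "x \<notin> V" using plane_drawingD(5)[OF pd e(1)] xe by blast
  moreover have "x \<in> S" using xe e IE meet[OF e(1)] by (fastforce simp: S_def)
  ultimately have "x \<in> W" using SW by blast
  then show False using WK xe e by (auto simp: carrier_def)
qed

text \<open>The term \<open>3 * ncomp V E\<close> lets the induction delete bridges: this costs one
  edge and gains at least one component. Without bridges, Euler's inequality and double counting
  apply. The \<open>+ 2\<close> covers drawings with at most two edges, where faces may touch fewer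
  than three.\<close>

lemma card_plane_drawing_ncomp:
  assumes "plane_drawing V E gam"
  shows "card E + 3 * ncomp V E \<le> 3 * card V + 2"
  using assms
proof (induction "card E" arbitrary: E rule: less_induct)
  case less
  note pd = less.prems
  note fin = plane_drawing_finite[OF pd]
  have edge: "\<exists>u v. e = {u, v} \<and> u \<in> V \<and> v \<in> V" if "e \<in> E" for e
    using plane_drawingD(1,2)[OF pd that] by (auto simp: card_2_iff)
  have endV: "u \<in> V \<and> v \<in> V" if "{u, v} \<in> E" for u v
    using plane_drawingD(1)[OF pd that] by simp
  consider "card E \<le> 2" | u v where "{u, v} \<in> E" "(u, v) \<notin> linked (E - {{u, v}})" "u \<in> V" "v \<in> V"
    | "\<not> card E \<le> 2" "\<And>u v. {u, v} \<in> E \<Longrightarrow> (u, v) \<in> linked (E - {{u, v}})"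
    using endV by blast
  then show ?case
  proof cases
    case 1
    then show ?thesis using ncomp_le_card[OF fin(1), of E] by linarith
  next
    case 2
    let ?E = "E - {{u, v}}"
    have "card ?E < card E" using 2 fin by (intro card_Diff1_less)
    moreover have "plane_drawing V ?E gam" by (rule plane_drawing_mono[OF pd]) blast
    ultimately have "card ?E + 3 * ncomp V ?E \<le> 3 * card V + 2" using less.hyps by blast
    moreover have "ncomp V E < ncomp V ?E"
      using ncomp_insert_bridge[OF fin(1) 2(3,4,2)] 2(1) by (simp add: insert_absorb)
    moreover have "card E = card ?E + 1" using 2 fin by (metis Suc_eq_plus1 card_Suc_Diff1)
    ultimately show ?thesis by linarith
  next
    case 3
    have cE: "3 \<le> card E" using 3(1) by linarith
    obtain \<F> where F: "finite \<F>" "\<F> \<subseteq> components (- carrier V E gam)"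
      "card E + ncomp V E \<le> card \<F> + card V"
      using Euler_lower_bound[OF pd] by blast
    let ?R = "\<lambda>W e. closure W \<inter> open_edge gam e \<noteq> {}"
    have "3 * card \<F> = (\<Sum>W\<in>\<F>. 3)" by simp
    also have "\<dots> \<le> (\<Sum>W\<in>\<F>. card {e \<in> E. ?R W e})"
      by (intro sum_mono card_edges_at_face[OF pd _ cE]) (use F in blast)
    also have "\<dots> = (\<Sum>e\<in>E. card {W \<in> \<F>. ?R W e})"
      by (rule sum_multicount_gen) (use F fin in auto)
    also have "\<dots> \<le> (\<Sum>e\<in>E. 2)"
    proof (rule sum_mono)
      fix e assume e: "e \<in> E"
      then obtain u v where uv: "e = {u, v}" using edge by blast
      have ins: "insert {u, v} (E - {{u, v}}) = E" using e uv by blast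
      show "card {W \<in> \<F>. ?R W e} \<le> 2"
        using card_faces_at_edge[of V u v "E - {{u, v}}" gam \<F>] pd F 3(2)[of u v] e
        unfolding ins uv by simp
    qed
    also have "\<dots> = 2 * card E" by simp
    \<comment> \<open>With \<open>f\<close> faces and \<open>c\<close> components,
      \<open>3 f \<le> 2 E\<close> and three times Euler's inequality give
      \<open>E + 3 c \<le> 3 V\<close>.\<close>
    finally show ?thesis using F(3) by linarith
  qed
qed

corollary card_plane_drawing: "plane_drawing V E gam \<Longrightarrow> card E \<le> 3 * card V + 2"
  using card_plane_drawing_ncomp[of V E gam] by linarith

section \<open>Orientations and averaging\<close>

text \<open>If all degrees were at least 11, the handshake count would give
  \<open>11 * card S \<le> 6 * card S + 4\<close>, which fails already for one vertex.\<close>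

lemma ex_small_degree:
  assumes "finite S" "S \<noteq> {}" "finite G" and G: "\<And>e. e \<in> G \<Longrightarrow> e \<subseteq> S \<and> card e = 2"
    and "card G \<le> 3 * card S + 2"
  shows "\<exists>v\<in>S. card {w. {v, w} \<in> G} \<le> 10"
proof (rule ccontr)
  assume "\<not> ?thesis"
  then have big: "11 \<le> card {w. {v, w} \<in> G}" if "v \<in> S" for v using that by fastforce
  have deg: "card {w. {v, w} \<in> G} \<le> card {e \<in> G. v \<in> e}" for v
  proof (rule card_inj_on_le[of "\<lambda>w. {v, w}"])
    show "inj_on (\<lambda>w. {v, w}) {w. {v, w} \<in> G}" by (auto simp: inj_on_def doubleton_eq_iff)
  qed (use \<open>finite G\<close> in auto)
  have "11 * card S \<le> (\<Sum>v\<in>S. card {e \<in> G. v \<in> e})"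
    using sum_mono[of S "\<lambda>_. 11" "\<lambda>v. card {e \<in> G. v \<in> e}"] big deg le_trans by fastforce
  also have "\<dots> = (\<Sum>e\<in>G. card {v \<in> S. v \<in> e})"
    by (rule sum_multicount_gen) (use assms in auto)
  also have "\<dots> = (\<Sum>e\<in>G. 2)"
  proof (rule sum.cong[OF refl])
    fix e assume "e \<in> G"
    then have "{v \<in> S. v \<in> e} = e" "card e = 2" using G by blast+
    then show "card {v \<in> S. v \<in> e} = 2" by simp
  qed
  also have "\<dots> = 2 * card G" by simp
  also have "\<dots> \<le> 2 * (3 * card S + 2)" by (rule mult_le_mono2) (rule assms(5))
  finally have "11 * card S \<le> 2 * (3 * card S + 2)" .
  moreover have "1 \<le> card S" using assms by (simp add: Suc_le_eq card_gt_0_iff)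
  ultimately show False by simp
qed

text \<open>Degeneracy: remove a vertex of degree at most \<open>d\<close>, orient the rest
  recursively, and direct all edges of the removed vertex away from it. \<open>N v\<close> is the
  set of out-neighbours of \<open>v\<close>.\<close>

lemma ex_bounded_orientation:
  fixes F :: "'a set set"
  assumes "finite V"
    and "\<And>S. S \<subseteq> V \<Longrightarrow> S \<noteq> {} \<Longrightarrow> \<exists>v\<in>S. card {w \<in> S. {v, w} \<in> F} \<le> d"
  shows "\<exists>N. (\<forall>v\<in>V. N v \<subseteq> {w \<in> V. {v, w} \<in> F} \<and> card (N v) \<le> d) \<and>
    (\<forall>u\<in>V. \<forall>v\<in>V. {u, v} \<in> F \<longrightarrow> u \<in> N v \<or> v \<in> N u)"
  using assms
proof (induction "card V" arbitrary: V rule: less_induct)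
  case less
  show ?case
  proof (cases "V = {}")
    case False
    then obtain v where v: "v \<in> V" "card {w \<in> V. {v, w} \<in> F} \<le> d"
      using less.prems(2) by blast
    let ?V = "V - {v}"
    have "card ?V < card V" using v less.prems(1) by (intro card_Diff1_less)
    moreover have "finite ?V" using less.prems(1) by simp
    moreover have "\<exists>v\<in>S. card {w \<in> S. {v, w} \<in> F} \<le> d" if "S \<subseteq> ?V" "S \<noteq> {}" for S
      using less.prems(2)[of S] that by blast
    ultimately have "\<exists>N. (\<forall>v\<in>?V. N v \<subseteq> {w \<in> ?V. {v, w} \<in> F} \<and> card (N v) \<le> d) \<and>
        (\<forall>u\<in>?V. \<forall>v\<in>?V. {u, v} \<in> F \<longrightarrow> u \<in> N v \<or> v \<in> N u)"
      by (rule less.hyps)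
    then obtain N where "\<forall>v\<in>?V. N v \<subseteq> {w \<in> ?V. {v, w} \<in> F} \<and> card (N v) \<le> d"
      "\<forall>u\<in>?V. \<forall>v\<in>?V. {u, v} \<in> F \<longrightarrow> u \<in> N v \<or> v \<in> N u"
      by (elim exE conjE)
    note N = this[rule_format]
    let ?N = "N(v := {w \<in> V. {v, w} \<in> F})"
    have "?N x \<subseteq> {w \<in> V. {x, w} \<in> F} \<and> card (?N x) \<le> d" if "x \<in> V" for x
      using N(1)[of x] v(2) that by auto
    moreover have "x \<in> ?N y \<or> y \<in> ?N x" if "x \<in> V" "y \<in> V" "{x, y} \<in> F" for x y
      using N(2)[of x y] that by (auto simp: insert_commute)
    ultimately show ?thesis by blast
  qed simp
qed

text \<open>A uniformly random \<open>T \<subseteq> V\<close> contains \<open>A h\<close> and misses \<open>B h\<close> with probability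
  at least \<open>2\<^sup>-\<^sup>k\<close>.\<close>

lemma card_le_by_sampling:
  assumes V: "finite V" and H: "finite H"
    and AB: "\<And>h. h \<in> H \<Longrightarrow> A h \<subseteq> V \<and> A h \<inter> B h = {} \<and> card (A h \<union> B h) \<le> k \<and> B h \<subseteq> V"
    and m: "\<And>T. T \<subseteq> V \<Longrightarrow> card {h \<in> H. A h \<subseteq> T \<and> T \<inter> B h = {}} \<le> m"
  shows "card H \<le> 2 ^ k * m"
proof -
  let ?R = "\<lambda>T h. A h \<subseteq> T \<and> T \<inter> B h = {}"
  have low: "2 ^ card V \<le> 2 ^ k * card {T \<in> Pow V. ?R T h}" if h: "h \<in> H" for h
  proof -
    let ?Z = "A h \<union> B h"
    have fZ: "finite ?Z" "?Z \<subseteq> V" using AB[OF h] V finite_subset by blast+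
    have "card (Pow (V - ?Z)) \<le> card {T \<in> Pow V. ?R T h}"
    \<comment> \<open>Adding \<open>A h\<close> to any subset of \<open>V\<close> that avoids
      \<open>A h\<close> and \<open>B h\<close> gives a good sample, and distinct subsets give
      distinct samples.\<close>
    proof (rule card_inj_on_le[of "\<lambda>T. T \<union> A h"])
      show "inj_on (\<lambda>T. T \<union> A h) (Pow (V - ?Z))" by (rule inj_onI) blast
      show "(\<lambda>T. T \<union> A h) ` Pow (V - ?Z) \<subseteq> {T \<in> Pow V. ?R T h}" using AB[OF h] by blast
    qed (use V in simp)
    moreover have "card (Pow (V - ?Z)) = 2 ^ (card V - card ?Z)"
      using V fZ by (simp add: card_Pow card_Diff_subset)
    ultimately have "2 ^ (card V - card ?Z) \<le> card {T \<in> Pow V. ?R T h}" by metis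
    then have le: "2 ^ k * 2 ^ (card V - card ?Z) \<le> 2 ^ k * card {T \<in> Pow V. ?R T h}"
      by (rule mult_le_mono2)
    have "(2::nat) ^ card V \<le> 2 ^ (k + (card V - card ?Z))"
      using AB[OF h] by (intro power_increasing) auto
    then show ?thesis unfolding power_add using le by (rule le_trans)
  qed
  \<comment> \<open>Double counting of the pairs of a sample \<open>T\<close> and an
    \<open>h\<close> that it keeps; the factor \<open>2 ^ card V\<close> cancels at the end.\<close>
  have "2 ^ card V * card H = (\<Sum>h\<in>H. 2 ^ card V)" by simp
  also have "\<dots> \<le> (\<Sum>h\<in>H. 2 ^ k * card {T \<in> Pow V. ?R T h})" by (rule sum_mono) (rule low)
  also have "\<dots> = 2 ^ k * (\<Sum>h\<in>H. card {T \<in> Pow V. ?R T h})" by (simp add: sum_distrib_left)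
  also have "(\<Sum>h\<in>H. card {T \<in> Pow V. ?R T h}) = (\<Sum>T\<in>Pow V. card {h \<in> H. ?R T h})"
    by (rule sum_multicount_gen[symmetric]) (use V H in auto)
  also have "\<dots> \<le> (\<Sum>T\<in>Pow V. m)" by (intro sum_mono m) blast
  also have "\<dots> = 2 ^ card V * m" using V by (simp add: card_Pow)
  finally show ?thesis by (simp add: mult.left_commute)
qed

section \<open>Planarly connected crossings\<close>

text \<open>Two edges of a topological graph meet only in common ends or crossing points, and the
  latter are excluded. The vertex set \<open>S\<close> is free so that induced subgraphs are
  covered, as degeneracy requires.\<close>

lemma noncrossing_plane_drawing:
  assumes tg: "topological_graph V E gam" and S: "S \<subseteq> V"
    and E': "E' \<subseteq> E" "\<And>e. e \<in> E' \<Longrightarrow> e \<subseteq> S"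
    and nc: "\<And>e f. e \<in> E' \<Longrightarrow> f \<in> E' \<Longrightarrow> \<not> edges_cross gam e f"
  shows "plane_drawing S E' gam"
proof -
  have V: "finite V" using tg unfolding topological_graph_def by (elim conjE)
  have edge: "card e = 2 \<and> arc (gam e) \<and> {pathstart (gam e), pathfinish (gam e)} = e \<and>
      path_image (gam e) \<inter> S \<subseteq> e" if "e \<in> E" for e
  proof -
    have "\<forall>v\<in>V. v \<in> path_image (gam e) \<longrightarrow> v \<in> e"
      using tg that by (simp add: topological_graph_def)
    then have "path_image (gam e) \<inter> S \<subseteq> e" using S by blast
    then show ?thesis using tg that by (simp add: topological_graph_def)
  qed
  have meet: "path_image (gam e) \<inter> path_image (gam f) \<subseteq> e \<inter> f"
    if "e \<in> E'" "f \<in> E'" "e \<noteq> f" for e f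
  proof
    fix p assume p: "p \<in> path_image (gam e) \<inter> path_image (gam f)"
    have "e \<in> E" "f \<in> E" using that E'(1) by blast+
    then have "p \<in> e \<inter> f \<or> crossing_point (gam e) (gam f) p"
      using tg p \<open>e \<noteq> f\<close> by (simp add: topological_graph_def)
    then show "p \<in> e \<inter> f" using nc[OF that(1,2)] by (auto simp: edges_cross_def)
  qed
  show ?thesis
    unfolding plane_drawing_def
  proof (intro conjI)
    show "finite S" using S V by (rule finite_subset)
    show "\<forall>e\<in>E'. e \<subseteq> S \<and> card e = 2 \<and> arc (gam e) \<and>
        {pathstart (gam e), pathfinish (gam e)} = e \<and> path_image (gam e) \<inter> S \<subseteq> e"
    proof
      fix e assume e: "e \<in> E'"
      then have "e \<in> E" using E'(1) by blast
      from edge[OF this] show "e \<subseteq> S \<and> card e = 2 \<and> arc (gam e) \<and>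
        {pathstart (gam e), pathfinish (gam e)} = e \<and> path_image (gam e) \<inter> S \<subseteq> e"
        by (intro conjI E'(2)[OF e]) (elim conjE, assumption)+
    qed
    show "\<forall>e\<in>E'. \<forall>f\<in>E'. e \<noteq> f \<longrightarrow> path_image (gam e) \<inter> path_image (gam f) \<subseteq> e \<inter> f"
      by (intro ballI impI meet)
  qed
qed

theorem theorem1:
  shows "\<exists>c::real. \<forall>V E gam.
     topological_graph V E gam \<and>
     (\<forall>e\<in>E. \<forall>e'\<in>E. edges_cross gam e e' \<longrightarrow>
         e \<inter> e' = {} \<and>
         (\<exists>g\<in>E. crossing_free E gam g \<and> (\<exists>u\<in>e. \<exists>w\<in>e'. g = {u, w})))
     \<longrightarrow> real (card E) \<le> c * real (card V)"
proof (intro exI allI impI, elim conjE)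
  fix V E gam
  assume tg: "topological_graph V E gam"
    and cross: "\<forall>e\<in>E. \<forall>e'\<in>E. edges_cross gam e e' \<longrightarrow> e \<inter> e' = {} \<and>
      (\<exists>g\<in>E. crossing_free E gam g \<and> (\<exists>u\<in>e. \<exists>w\<in>e'. g = {u, w}))"
  have finV: "finite V" and EV: "\<And>e. e \<in> E \<Longrightarrow> e \<subseteq> V \<and> card e = 2"
    using tg by (simp_all add: topological_graph_def)
  have "E \<subseteq> Pow V" using EV by blast
  then have finE: "finite E" using finV by (simp add: finite_subset)
  define F where "F = {e \<in> E. crossing_free E gam e}"
  have FE: "F \<subseteq> E" and finF: "finite F" using finE by (auto simp: F_def)
  have Fpd: "plane_drawing S {e \<in> F. e \<subseteq> S} gam" if "S \<subseteq> V" for S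
  proof (rule noncrossing_plane_drawing[OF tg that])
    show "{e \<in> F. e \<subseteq> S} \<subseteq> E" using FE by blast
    show "\<not> edges_cross gam e f" if "e \<in> {e \<in> F. e \<subseteq> S}" "f \<in> {e \<in> F. e \<subseteq> S}" for e f
      using that by (simp add: F_def crossing_free_def)
  qed blast
  have low_degree: "\<exists>v\<in>S. card {w \<in> S. {v, w} \<in> F} \<le> 10" if S: "S \<subseteq> V" "S \<noteq> {}" for S
  proof -
    have "\<exists>v\<in>S. card {w. {v, w} \<in> {e \<in> F. e \<subseteq> S}} \<le> 10"
    proof (rule ex_small_degree)
      show "finite S" using S(1) finV by (rule finite_subset)
      show "card {e \<in> F. e \<subseteq> S} \<le> 3 * card S + 2" by (rule card_plane_drawing[OF Fpd[OF S(1)]])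
      show "e \<subseteq> S \<and> card e = 2" if "e \<in> {e \<in> F. e \<subseteq> S}" for e using that FE EV by blast
    qed (use S finF in simp_all)
    then obtain v where "v \<in> S" "card {w. {v, w} \<in> {e \<in> F. e \<subseteq> S}} \<le> 10" by blast
    moreover from this have "{w. {v, w} \<in> {e \<in> F. e \<subseteq> S}} = {w \<in> S. {v, w} \<in> F}" by auto
    ultimately show ?thesis by auto
  qed
  have "\<exists>N. (\<forall>v\<in>V. N v \<subseteq> {w \<in> V. {v, w} \<in> F} \<and> card (N v) \<le> 10) \<and>
      (\<forall>u\<in>V. \<forall>v\<in>V. {u, v} \<in> F \<longrightarrow> u \<in> N v \<or> v \<in> N u)"
    by (rule ex_bounded_orientation[OF finV]) (rule low_degree)
  then obtain N
    where "\<forall>v\<in>V. N v \<subseteq> {w \<in> V. {v, w} \<in> F} \<and> card (N v) \<le> 10"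
      "\<forall>u\<in>V. \<forall>v\<in>V. {u, v} \<in> F \<longrightarrow> u \<in> N v \<or> v \<in> N u"
    by (elim exE conjE)
  note N = this(1)[rule_format] and NF = this(2)[rule_format]
  define B where "B e = (\<Union>v\<in>e. N v)" for e
  \<comment> \<open>The exponent counts the vertices whose status decides whether an edge is kept: 2
    ends and at most 10 out-neighbours of each.\<close>
  have "card (E - F) \<le> 2 ^ 22 * (3 * card V + 2)"
  proof (rule card_le_by_sampling[OF finV, where A = "\<lambda>e. e" and B = B])
    show "finite (E - F)" using finE by simp
    show "e \<subseteq> V \<and> e \<inter> B e = {} \<and> card (e \<union> B e) \<le> 22 \<and> B e \<subseteq> V" if e: "e \<in> E - F" for e
    proof -
      obtain u v where uv: "e = {u, v}" "u \<noteq> v" using EV e card2_obtain by (metis DiffD1)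
      have V: "u \<in> V" "v \<in> V" and nF: "{u, v} \<notin> F" "{v, u} \<notin> F"
        using EV e uv by (auto simp: insert_commute)
      have nloop: "{x, x} \<notin> F" for x using EV FE by fastforce
      \<comment> \<open>An end of \<open>e\<close> in \<open>B e\<close> would make \<open>e\<close>
        itself, or a loop, a member of \<open>F\<close>.\<close>
      have "e \<inter> B e = {}" using N[OF V(1)] N[OF V(2)] nF nloop by (auto simp: uv B_def)
      moreover have "B e \<subseteq> V" using N[OF V(1)] N[OF V(2)] by (auto simp: uv B_def)
      moreover have "card (e \<union> B e) \<le> 22"
      proof -
        have "card (e \<union> B e) \<le> card e + card (N u \<union> N v)"
          using card_Un_le[of e "B e"] by (simp add: uv B_def)
        also have "\<dots> \<le> 2 + (10 + 10)"
          using card_Un_le[of "N u" "N v"] N[OF V(1)] N[OF V(2)] uv by simp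
        finally show ?thesis by simp
      qed
      ultimately show ?thesis using V uv by blast
    qed
    show "card {e \<in> E - F. e \<subseteq> T \<and> T \<inter> B e = {}} \<le> 3 * card V + 2" if T: "T \<subseteq> V" for T
    proof -
      let ?E = "{e \<in> E - F. e \<subseteq> T \<and> T \<inter> B e = {}}"
      have "plane_drawing V ?E gam"
      proof (rule noncrossing_plane_drawing[OF tg])
        show "\<not> edges_cross gam e f" if ef: "e \<in> ?E" "f \<in> ?E" for e f
        proof
          assume "edges_cross gam e f"
          moreover have "e \<in> E" "f \<in> E" using ef by blast+
          ultimately obtain g u w where "g \<in> E" "crossing_free E gam g" "u \<in> e" "w \<in> f" "g = {u, w}"
            using cross by meson
          then have uw: "u \<in> e" "w \<in> f" "{u, w} \<in> F" by (simp_all add: F_def)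
          then have "u \<in> T" "w \<in> T" using ef by auto
          \<comment> \<open>The crossing-free edge is oriented one way or the other, so one of its
            ends is an out-neighbour of the other and lies in \<open>T\<close>; the kept edge at the
            tail should have excluded it.\<close>
          then have "u \<in> N w \<or> w \<in> N u" using NF uw T by blast
          then have "T \<inter> B e \<noteq> {} \<or> T \<inter> B f \<noteq> {}" using uw \<open>u \<in> T\<close> \<open>w \<in> T\<close> by (auto simp: B_def)
          then show False using ef by blast
        qed
      qed (use EV in auto)
      then show ?thesis by (rule card_plane_drawing)
    qed
  qed
  moreover have "card F \<le> 3 * card V + 2"
  proof -
    have "{e \<in> F. e \<subseteq> V} = F" using FE EV by blast
    then show ?thesis using card_plane_drawing[OF Fpd[of V]] by simp
  qed
  moreover have "card E = card F + card (E - F)"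
    using FE finE finF by (simp add: card_Diff_subset card_mono)
  ultimately have bound: "card E \<le> (1 + 2 ^ 22) * (3 * card V + 2)" by (simp add: algebra_simps)
  \<comment> \<open>The additive constant is absorbed when there is a vertex; without vertices there
    are no edges.\<close>
  have "card E \<le> (1 + 2 ^ 22) * (5 * card V)"
  proof (cases "V = {}")
    case True
    then have "E = {}" using EV by fastforce
    then show ?thesis by simp
  next
    case False
    then have "1 \<le> card V" using finV by (simp add: Suc_le_eq card_gt_0_iff)
    then have "3 * card V + 2 \<le> 5 * card V" by simp
    then have "(1 + 2 ^ 22) * (3 * card V + 2) \<le> (1 + 2 ^ 22) * (5 * card V)" by (rule mult_le_mono2)
    then show ?thesis using bound by (rule le_trans[rotated])
  qed
  then have "real (card E) \<le> real ((1 + 2 ^ 22) * (5 * card V))" by (rule of_nat_mono)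
  then show "real (card E) \<le> (5 * (1 + 2 ^ 22)) * real (card V)" by simp
qed

end
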